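(* Let $G$ be a finite, simple, undirected, connected graph containing a vertex $v$ such that every pair of non-adjacent (distinct) vertices $u, w\in \mathcal{N}(v)$ are in a $4$-cycle in $G$ (i.e. there is a $4$-cycle of $G$ containing both $u$ and $w$). If $G-v$ is distance preserving, then so is $G$.
   Context: All graphs are finite, undirected, simple, and connected. $\mathcal{N}(v)$ denotes the neighborhood of $v$, i.e. the set of vertices adjacent to $v$ in $G$. $G-v$ is the subgraph induced by $V(G)\setminus\{v\}$. A $4$-cycle in $G$ is a (not necessarily induced) cycle of length $4$. The distance $d_G(u,v)$ is the minimal length (number of edges) of a path in $G$ connecting $u$ and $v$. An induced subgraph $H$ of $G$ is called an isometric subgraph of $G$ if $d_H(a,b)=d_G(a,b)$ for every pair of vertices $a,b\in V(H)$ (in particular, since $G$ is connected, an isometric subgraph is connected). A connected graph $G$ is called distance preserving (dp) if and only if it has an isometric subgraph with exactly $i$ vertices for every $1\le i\le |V(G)|$. *)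

theory Defs
  imports "Graph_Theory.Graph_Theory"
begin

text \<open>
  Finite simple undirected graphs are the digraphs satisfying \<^locale>\<open>graph\<close>:
  finite, loop-free, without parallel arcs, and symmetric, so that an edge is a
  pair of opposite arcs.
\<close>

definition neighborhood :: "('a, 'b) pre_digraph \<Rightarrow> 'a \<Rightarrow> 'a set" where
  "neighborhood G v = {u \<in> verts G. v \<rightarrow>\<^bsub>G\<^esub> u}"

definition graph_dist :: "('a, 'b) pre_digraph \<Rightarrow> 'a \<Rightarrow> 'a \<Rightarrow> ereal" where
  "graph_dist G u v = wf_digraph.\<mu> G (\<lambda>_. 1) u v"

text \<open>
  The library takes the infimum over walks, with value \<open>\<infinity>\<close> if there are none; the
  following fact confirms that this is the minimal number of edges of a path.
\<close>

lemma (in fin_digraph) graph_dist_eq_Min_apath: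
  assumes "u \<rightarrow>\<^sup>*\<^bsub>G\<^esub> v"
  shows "graph_dist G u v = ereal (real (Min (length ` {p. apath u p v})))"
proof -
  have cost: "awalk_cost (\<lambda>_. 1) p = real (length p)" for p :: "'b list"
    by (induction p) auto
  obtain p where p: "apath u p v" "\<mu> (\<lambda>_. 1) u v = ereal (real (length p))"
    using min_cost_awalk[OF assms, of "\<lambda>_. 1"] by (auto simp: cost)
  have "length p \<le> length q" if "apath u q v" for q
  proof -
    have "awalk u q v"
      using that by (simp add: apath_def)
    from min_cost_le_walk_cost[OF this, of "\<lambda>_. 1"] show ?thesis
      by (simp add: p(2) cost)
  qed
  then have "Min (length ` {p. apath u p v}) = length p"
    using p(1) by (intro Min_eqI) (auto intro: apaths_finite)
  then show ?thesis
    by (simp add: graph_dist_def p(2))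
qed

text \<open>
  On a cycle every vertex is the tail of exactly one arc. At length 4 the library's
  distinctness condition rules out degenerate closed walks such as \<open>a, b, a, b, a\<close>.
\<close>

definition in_common_4_cycle :: "('a, 'b) pre_digraph \<Rightarrow> 'a \<Rightarrow> 'a \<Rightarrow> bool" where
  "in_common_4_cycle G u w \<longleftrightarrow>
    (\<exists>p. pre_digraph.cycle G p \<and> length p = 4 \<and> {u, w} \<subseteq> tail G ` set p)"

definition isometric_subgraph :: "('a, 'b) pre_digraph \<Rightarrow> ('a, 'b) pre_digraph \<Rightarrow> bool" where
  "isometric_subgraph H G \<longleftrightarrow>
    induced_subgraph H G \<and>
    (\<forall>a\<in>verts H. \<forall>b\<in>verts H. graph_dist H a b = graph_dist G a b)"

text \<open>
  \<^const>\<open>connected\<close> excludes the graph without vertices.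
\<close>

definition distance_preserving :: "('a, 'b) pre_digraph \<Rightarrow> bool" where
  "distance_preserving G \<longleftrightarrow>
    connected G \<and>
    (\<forall>i\<in>{1..card (verts G)}. \<exists>H. isometric_subgraph H G \<and> card (verts H) = i)"

end

theory Submission
  imports Defs
begin

text \<open>
  The vertex \<open>v\<close> is never needed for shortest walks between other vertices: if a walk
  passes \<open>u, v, w\<close>, then \<open>u\<close> and \<open>w\<close> coincide, are adjacent, or are opposite
  vertices of a 4-cycle and so have a common neighbour besides \<open>v\<close>. Thus \<open>G - v\<close> is
  isometric in \<open>G\<close>, its isometric subgraphs are isometric in \<open>G\<close>, and the only size
  that they do not provide is that of \<open>G\<close> itself.
\<close>

lemma (in wf_digraph) awalk_cost_unit: "awalk_cost (\<lambda>_. 1) p = real (length p)"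
  by (induction p) auto

text \<open>Distances are infima of walk lengths, so comparing walks one at a time is enough.
  Reachability need not be treated separately: without any walk in \<open>G\<close> the right-hand
  side is \<open>\<infinity>\<close>.\<close>

lemma graph_dist_leI:
  assumes "wf_digraph G" and "wf_digraph H"
    and "\<And>p. pre_digraph.awalk G a p b
      \<Longrightarrow> \<exists>q. pre_digraph.awalk H a q b \<and> length q \<le> length p"
  shows "graph_dist H a b \<le> graph_dist G a b"
  unfolding graph_dist_def wf_digraph.\<mu>_def[OF assms(1)] wf_digraph.\<mu>_def[OF assms(2)]
  using assms(3)
  by (intro INF_mono)
    (simp add: wf_digraph.awalk_cost_unit[OF assms(1)] wf_digraph.awalk_cost_unit[OF assms(2)])

lemma (in wf_digraph) graph_dist_subgraph_ge:
  assumes "subgraph H G"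
  shows "graph_dist G a b \<le> graph_dist H a b"
  using assms by (intro graph_dist_leI) (auto intro: subgraph_awalk_imp_awalk wf_digraph_axioms)

lemma (in wf_digraph) awalk_prepend_adj:
  assumes "x \<rightarrow> y" and "awalk y q b"
  obtains e where "awalk x (e # q) b"
  using assms by (auto simp: arcs_ends_conv awalk_Cons_iff)

lemma induced_subgraph_trans:
  assumes "induced_subgraph H K" and "induced_subgraph K G"
  shows "induced_subgraph H G"
  using assms unfolding induced_subgraph_def subgraph_def compatible_def by auto

lemma isometric_subgraph_trans:
  assumes "isometric_subgraph H K" and "isometric_subgraph K G"
  shows "isometric_subgraph H G"
proof -
  have "verts H \<subseteq> verts K"
    using assms(1) by (auto simp: isometric_subgraph_def)
  then show ?thesis
    using assms unfolding isometric_subgraph_def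
    by (simp add: subset_eq) (blast intro: induced_subgraph_trans)
qed

text \<open>Distinct non-adjacent vertices of a 4-cycle lie opposite each other, so the other two
  vertices of the cycle are both common neighbours. These differ, hence at least one of them is not
  the arbitrary vertex \<open>v\<close>.\<close>

lemma (in graph) in_common_4_cycle_common_neighbour:
  assumes "in_common_4_cycle G u w" and "u \<noteq> w" and "\<not> u \<rightarrow> w"
  obtains x where "x \<noteq> v" and "u \<rightarrow> x" and "x \<rightarrow> w"
proof -
  obtain p a where p: "awalk a p a" "distinct (tl (awalk_verts a p))" "length p = 4"
    "u \<in> tail G ` set p" "w \<in> tail G ` set p"
    using assms(1) by (auto simp: in_common_4_cycle_def cycle_def)
  obtain e\<^sub>1 e\<^sub>2 e\<^sub>3 e\<^sub>4 where "p = [e\<^sub>1, e\<^sub>2, e\<^sub>3, e\<^sub>4]"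
    using p(3) by (auto simp: numeral_eq_Suc length_Suc_conv)
  then have e: "{e\<^sub>1, e\<^sub>2, e\<^sub>3, e\<^sub>4} \<subseteq> arcs G" "tail G e\<^sub>1 = a"
      "head G e\<^sub>1 = tail G e\<^sub>2" "head G e\<^sub>2 = tail G e\<^sub>3" "head G e\<^sub>3 = tail G e\<^sub>4" "head G e\<^sub>4 = a"
    \<comment> \<open>The closed walk visits \<open>a\<close> first and last; \<open>tl\<close>
      drops the first visit only, so distinctness still separates \<open>a\<close> from the opposite
      vertex.\<close>
    and dist: "a \<noteq> tail G e\<^sub>3" "tail G e\<^sub>2 \<noteq> tail G e\<^sub>4"
    and uw: "u \<in> {a, tail G e\<^sub>2, tail G e\<^sub>3, tail G e\<^sub>4}" "w \<in> {a, tail G e\<^sub>2, tail G e\<^sub>3, tail G e\<^sub>4}"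
    using p by (simp_all add: awalk_simps eq_commute[of "tail G e\<^sub>1"])
  have arc: "tail G e \<rightarrow> head G e" if "e \<in> arcs G" for e
    using that by (intro dominatesI) (simp_all add: arc_to_ends_def)
  define b c d where bcd: "b = tail G e\<^sub>2" "c = tail G e\<^sub>3" "d = tail G e\<^sub>4"
  have adj: "a \<rightarrow> b" "b \<rightarrow> c" "c \<rightarrow> d" "d \<rightarrow> a"
    using arc[of e\<^sub>1] arc[of e\<^sub>2] arc[of e\<^sub>3] arc[of e\<^sub>4] e by (simp_all add: bcd)
  note sym = adj[THEN graph_symmetric]
  \<comment> \<open>Equal choices contradict \<open>u \<noteq> w\<close>, and consecutive ones
    contradict non-adjacency, with \<open>sym\<close> covering the reverse direction. Only the two
    diagonals remain, each in both orders.\<close>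
  consider "u = a" "w = c" | "u = c" "w = a" | "u = b" "w = d" | "u = d" "w = b"
    using uw[folded bcd] adj sym assms(2,3)
    unfolding insert_iff empty_iff by (elim disjE) simp_all
  then have "u \<rightarrow> a \<and> a \<rightarrow> w \<and> u \<rightarrow> c \<and> c \<rightarrow> w \<or> u \<rightarrow> b \<and> b \<rightarrow> w \<and> u \<rightarrow> d \<and> d \<rightarrow> w"
    by cases (simp_all add: adj sym)
  moreover have "a \<noteq> c" "b \<noteq> d"
    using dist by (simp_all add: bcd)
  ultimately show ?thesis
    using that[of a] that[of b] that[of c] that[of d] by argo
qed

text \<open>The walk is repaired from its front: a visit to \<open>v\<close> directly after the
  start is replaced by a detour with no more arcs, and later visits are left to the
  induction.\<close>

lemma (in graph) awalk_avoiding: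
  assumes nbr: "\<And>u w. \<lbrakk>u \<in> neighborhood G v; w \<in> neighborhood G v; u \<noteq> w; \<not> u \<rightarrow> w\<rbrakk>
      \<Longrightarrow> in_common_4_cycle G u w"
    and "awalk a p b" and "a \<noteq> v" and "b \<noteq> v"
  shows "\<exists>q. pre_digraph.awalk (G \<restriction> (verts G - {v})) a q b \<and> length q \<le> length p"
  using assms(2,3)
\<comment> \<open>When the second vertex is \<open>v\<close>, the hypothesis is needed for the walk
  with two arcs removed, since the walk with one arc removed starts at \<open>v\<close>.\<close>
proof (induction p arbitrary: a rule: length_induct)
  case (1 p)
  let ?K = "G \<restriction> (verts G - {v})"
  interpret K: wf_digraph ?K by (rule wellformed_induce_subgraph)
  have K_adj: "x \<rightarrow>\<^bsub>?K\<^esub> y" if "x \<rightarrow> y" "x \<noteq> v" "y \<noteq> v" for x y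
    using that adj_in_verts[OF that(1)] by (auto simp: arcs_ends_conv)
  have in_verts: "a \<in> verts G"
    using "1.prems" by auto
  show ?case
  proof (cases p)
    case Nil
    then show ?thesis
      using "1.prems" in_verts by (auto simp: K.awalk_Nil_iff awalk_Nil_iff)
  next
    case (Cons e q)
    define c where "c = head G e"
    have ac: "a \<rightarrow> c" and q: "awalk c q b"
      using "1.prems" Cons by (auto simp: awalk_Cons_iff arcs_ends_conv c_def)
    show ?thesis
    proof (cases "c = v")
      case False
      then obtain q' where q': "K.awalk c q' b" "length q' \<le> length q"
        using "1.IH" q Cons by auto
      obtain e' where "K.awalk a (e' # q') b"
        using K.awalk_prepend_adj[OF K_adj[OF ac "1.prems"(2) False] q'(1)] .
      then show ?thesis
        using q' Cons by (intro exI[of _ "e' # q'"]) simp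
    next
      case True
      \<comment> \<open>The walk cannot end at \<open>v\<close> because \<open>b \<noteq> v\<close>,
        so another arc leaves \<open>v\<close>.\<close>
      then obtain f r where q_eq: "q = f # r"
        using q \<open>b \<noteq> v\<close> by (cases q) (auto simp: awalk_Nil_iff)
      define w where "w = head G f"
      have vw: "v \<rightarrow> w" and r: "awalk w r b"
        using q q_eq True by (auto simp: awalk_Cons_iff arcs_ends_conv w_def)
      have "w \<noteq> v"
        using vw adj_not_same by auto
      then obtain r' where r': "K.awalk w r' b" "length r' \<le> length r"
        using "1.IH"[rule_format, of r w] r Cons q_eq by auto
      have len: "length p = Suc (Suc (length r))"
        using Cons q_eq by simp
      \<comment> \<open>The two arcs through \<open>v\<close> are replaced by none, one or two arcs
        in the respective cases.\<close>
      consider "a = w" | "a \<rightarrow> w" | "a \<noteq> w" "\<not> a \<rightarrow> w"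
        by blast
      then show ?thesis
      proof cases
        case 1
        then show ?thesis
          using r' len by (intro exI[of _ r']) simp
      next
        case 2
        obtain g where "K.awalk a (g # r') b"
          using K.awalk_prepend_adj[OF K_adj[OF 2 "1.prems"(2) \<open>w \<noteq> v\<close>] r'(1)] .
        then show ?thesis
          using r' len by (intro exI[of _ "g # r'"]) simp
      next
        case 3
        have "in_common_4_cycle G a w"
          using 3 graph_symmetric[OF ac] vw True in_verts adj_in_verts(2)[OF vw]
          by (intro nbr) (simp_all add: neighborhood_def)
        then obtain x where x: "x \<noteq> v" "a \<rightarrow> x" "x \<rightarrow> w"
          using 3 by (rule in_common_4_cycle_common_neighbour)
        obtain g where g: "K.awalk x (g # r') b"
          using K.awalk_prepend_adj[OF K_adj[OF x(3,1) \<open>w \<noteq> v\<close>] r'(1)] .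
        obtain h where "K.awalk a (h # g # r') b"
          using K.awalk_prepend_adj[OF K_adj[OF x(2) "1.prems"(2) x(1)] g] .
        then show ?thesis
          using r' len by (intro exI[of _ "h # g # r'"]) simp
      qed
    qed
  qed
qed

theorem theorem3p3:
  fixes G :: "('a, 'b) pre_digraph" and v :: 'a
  assumes "graph G"
    and "connected G"
    and "v \<in> verts G"
    and "\<And>u w. \<lbrakk>u \<in> neighborhood G v; w \<in> neighborhood G v; u \<noteq> w; \<not> u \<rightarrow>\<^bsub>G\<^esub> w\<rbrakk>
           \<Longrightarrow> in_common_4_cycle G u w"
    and "distance_preserving (G \<restriction> (verts G - {v}))"
  shows "distance_preserving G"
proof -
  interpret graph G by fact
  let ?K = "G \<restriction> (verts G - {v})"
  have ind: "induced_subgraph ?K G"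
    by (rule induced_induce) auto
  have "graph_dist ?K a b = graph_dist G a b" if "a \<in> verts ?K" "b \<in> verts ?K" for a b
  \<comment> \<open>Rerouting around \<open>v\<close> gives one inequality; the other holds in any
    subgraph, whose walks are walks of \<open>G\<close>.\<close>
  proof (rule antisym)
    show "graph_dist ?K a b \<le> graph_dist G a b"
      using that assms(4)
      by (intro graph_dist_leI awalk_avoiding wf_digraph_axioms wellformed_induce_subgraph) auto
    show "graph_dist G a b \<le> graph_dist ?K a b"
      using ind by (intro graph_dist_subgraph_ge induced_imp_subgraph)
  qed
  with ind have iso: "isometric_subgraph ?K G"
    by (simp add: isometric_subgraph_def)
  have "\<exists>H. isometric_subgraph H G \<and> card (verts H) = i" if i: "i \<in> {1..card (verts G)}" for i
  proof (cases "i = card (verts G)")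
    case True
    then show ?thesis
      using induced_subgraph_refl by (auto simp: isometric_subgraph_def)
  next
    case False
    \<comment> \<open>Deleting \<open>v\<close> lowers the number of vertices by exactly one, so
      every size below that of \<open>G\<close> is in range for \<open>?K\<close>.\<close>
    then have "i \<in> {1..card (verts ?K)}"
      using i assms(3) by auto
    then show ?thesis
      using assms(5) iso unfolding distance_preserving_def
      by (meson isometric_subgraph_trans)
  qed
  with assms(2) show ?thesis
    by (simp add: distance_preserving_def)
qed

end
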